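(* Let $s:\mathbb N\to\mathbb R$ be a real sequence satisfying $s(0)\ge 0$, and let $p\in\mathbb N$ be such that the sequence $\Delta^p s$ is concave and is not bounded from above. Then: (1) $s(n)>0$ for every $n\in\mathbb Z_+$; (2) $s$ is strictly increasing; (3) $\lim_{n\to+\infty}\frac{s(n)}{n^p}=+\infty$ (and consequently $\lim_{n\to+\infty}s(n)=+\infty$); (4) the sequence $\bigl(\frac{s(n)}{n^{p+1}}\bigr)_{n\in\mathbb Z_+}$ is bounded; (5) $\lim_{n\to+\infty}\frac{s(n+1)}{s(n)}=1$; (6) $\Delta^{p+2}s\in\ell_1$. If in addition $p\in\mathbb Z_+$, then the sequence $s$ is also convex.
   Context: $\mathbb N$ is the set of nonnegative integers and $\mathbb Z_+$ the set of strictly positive integers. The linear operator $\Delta$ on real sequences indexed by $\mathbb N$ is defined by $(\Delta a)(0)=a(0)$ and $(\Delta a)(n)=a(n)-a(n-1)$ for $n\in\mathbb Z_+$; $\Delta^p$ is its $p$-th iterate ($\Delta^0$ is the identity). A real sequence $a:\mathbb N\to\mathbb R$ is concave (convex) if the sequence $(a(n+1)-a(n))_{n\in\mathbb N}$ is nonincreasing (nondecreasing). $\ell_1$ is the space of absolutely summable sequences indexed by $\mathbb N$. *)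

theory Defs
  imports "HOL-Analysis.Analysis"
begin

text \<open>The backward difference with the convention \<open>a(-1) = 0\<close>; its iterates are
  \<open>(\<Delta> ^^ p) a\<close>.\<close>

definition seq_diff :: "(nat \<Rightarrow> real) \<Rightarrow> nat \<Rightarrow> real" (\<open>\<Delta>\<close>)
  where "\<Delta> a n = (if n = 0 then a 0 else a n - a (n - 1))"

definition concave_seq :: "(nat \<Rightarrow> real) \<Rightarrow> bool"
  where "concave_seq a \<longleftrightarrow> decseq (\<lambda>n. a (n + 1) - a n)"

definition convex_seq :: "(nat \<Rightarrow> real) \<Rightarrow> bool"
  where "convex_seq a \<longleftrightarrow> incseq (\<lambda>n. a (n + 1) - a n)"

definition ell1 :: "(nat \<Rightarrow> real) set" (\<open>\<ell>\<^sub>1\<close>)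
  where "\<ell>\<^sub>1 = {a. summable (\<lambda>n. \<bar>a n\<bar>)}"

end

theory Submission
  imports Defs
begin

text \<open>
  The growth properties are inherited by \<open>s\<close> from \<open>\<Delta> s\<close>, so they follow by induction on \<open>p\<close>.
  The invariant carrying the induction is \<open>n \<cdot> \<Delta> s n \<le> (p + 1) \<cdot> s n\<close>: for concave \<open>s\<close> (\<open>p = 0\<close>) it
  compares the last increment with the average one, and if \<open>u = \<Delta> s\<close> is increasing and satisfies
  it with constant \<open>q\<close>, summing \<open>k u k - (k - 1) u (k - 1) = u (k - 1) + k \<cdot> \<Delta> u k \<le> (q + 1) u k\<close>
  gives it for \<open>s\<close> with \<open>q + 1\<close>. The invariant bounds \<open>s\<close> below by \<open>n \<cdot> \<Delta> s n / (p + 1)\<close>, whence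
  the divergence of \<open>s n / n ^ p\<close>, and it bounds \<open>1 - s n / s (n + 1)\<close> by \<open>(p + 1) / (n + 1)\<close>.
\<close>

lemma seq_diff_0 [simp]: "\<Delta> a 0 = a 0"
  by (simp add: seq_diff_def)

lemma seq_diff_Suc [simp]: "\<Delta> a (Suc n) = a (Suc n) - a n"
  by (simp add: seq_diff_def)

lemma strict_mono_nonneg_pos:
  fixes s :: "nat \<Rightarrow> real"
  assumes "strict_mono s" "s 0 \<ge> 0" "n \<ge> 1"
  shows "s n > 0"
  using strict_monoD[OF assms(1), of 0 n] assms(2,3) by simp

text \<open>Increments never grow, so one nonpositive increment at \<open>n\<close> makes
  \<open>t\<close> nonincreasing from \<open>n\<close> on, and the finitely many values up to
  \<open>n\<close> then bound it.\<close>

lemma concave_unbounded_increments_pos: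
  assumes "concave_seq t" and "\<not> bdd_above (range t)"
  shows "t (Suc n) - t n > 0"
proof (rule ccontr)
  assume neg: "\<not> t (Suc n) - t n > 0"
  have step: "t (Suc k) \<le> t k" if "k \<ge> n" for k
    using assms(1) neg that decseqD[of "\<lambda>n. t (n + 1) - t n" n k]
    unfolding concave_seq_def by simp
  have tail: "t k \<le> t n" if "k \<ge> n" for k
    using that by (induction rule: dec_induct) (auto intro: order_trans[OF step])
  have "t k \<le> Max (t ` {..n})" for k
  proof (cases "k \<le> n")
    case False
    then have "t k \<le> t n" using tail by simp
    also have "\<dots> \<le> Max (t ` {..n})" by simp
    finally show ?thesis .
  qed simp
  then show False using assms(2) by (auto simp: bdd_above_def)
qed

lemma concave_unbounded_strict_mono:
  assumes "concave_seq t" and "\<not> bdd_above (range t)"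
  shows "strict_mono t"
  using concave_unbounded_increments_pos[OF assms] by (simp add: strict_mono_Suc_iff)

lemma concave_last_increment_le:
  assumes "concave_seq t"
  shows "real n * \<Delta> t n \<le> t n - t 0"
proof (induction n)
  case (Suc n)
  show ?case
  proof (cases n)
    case (Suc m)
    have "\<Delta> t (Suc n) \<le> \<Delta> t n"
      using assms Suc unfolding concave_seq_def by (simp add: decseq_Suc_iff)
    then have "real n * \<Delta> t (Suc n) \<le> real n * \<Delta> t n"
      by (rule mult_left_mono) simp
    with Suc.IH show ?thesis by (simp add: algebra_simps)
  qed simp
qed simp

lemma concave_le_linear:
  assumes "concave_seq t"
  shows "t n \<le> t 0 + real n * (t 1 - t 0)"
proof (induction n)
  case (Suc n)
  have "t (Suc n) - t n \<le> t 1 - t 0"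
    using assms decseqD[of "\<lambda>n. t (n + 1) - t n" 0 n] unfolding concave_seq_def by simp
  with Suc show ?case by (simp add: algebra_simps)
qed simp

lemma strict_mono_unbounded_at_top:
  fixes t :: "nat \<Rightarrow> real"
  assumes "strict_mono t" and "\<not> bdd_above (range t)"
  shows "filterlim t at_top sequentially"
  unfolding filterlim_at_top
proof
  fix Z
  obtain N where "Z \<le> t N"
    using assms(2) unfolding bdd_above_def by (metis linear rangeE)
  then show "\<forall>\<^sub>F n in sequentially. Z \<le> t n"
    using strict_mono_leD[OF assms(1)] unfolding eventually_sequentially by (meson order_trans)
qed

text \<open>The increments are positive and nonincreasing, hence convergent, and their successive
  drops form a telescoping series.\<close>

lemma concave_unbounded_second_diff_summable:
  assumes "concave_seq t" and "\<not> bdd_above (range t)"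
  shows "\<Delta> (\<Delta> t) \<in> \<ell>\<^sub>1"
proof -
  define d where "d n = t (Suc n) - t n" for n
  have dec: "decseq d"
    using assms(1) by (simp add: concave_seq_def d_def[abs_def])
  have "0 \<le> d n" for n
    using concave_unbounded_increments_pos[OF assms, of n] by (simp add: d_def)
  with dec obtain L where "d \<longlonglongrightarrow> L"
    using decseq_convergent[of d 0] by blast
  then have "summable (\<lambda>n. d n - d (Suc n))" by (rule telescope_summable')
  \<comment> \<open>The shift by 2 skips the two terms affected by the convention at index
    0.\<close>
  moreover have "\<bar>\<Delta> (\<Delta> t) (n + 2)\<bar> = d n - d (Suc n)" for n
    using decseq_SucD[OF dec, of n] by (simp add: d_def)
  ultimately have "summable (\<lambda>n. \<bar>\<Delta> (\<Delta> t) (n + 2)\<bar>)" by simp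
  then show ?thesis
    unfolding ell1_def mem_Collect_eq by (rule iffD1[OF summable_iff_shift])
qed

lemma seq_diff_weighted_step:
  assumes "strict_mono (\<Delta> s)" and "\<And>n. real n * \<Delta> (\<Delta> s) n \<le> q * \<Delta> s n"
    and "q \<ge> 0" "s 0 \<ge> 0"
  shows "real n * \<Delta> s n \<le> (q + 1) * s n"
proof (induction n)
  case 0
  then show ?case using assms(3,4) by simp
next
  case (Suc n)
  have "real (Suc n) * (\<Delta> s (Suc n) - \<Delta> s n) \<le> q * \<Delta> s (Suc n)"
    using assms(2)[of "Suc n"] by (simp only: seq_diff_Suc)
  moreover have "\<Delta> s n \<le> \<Delta> s (Suc n)"
    using strict_mono_leD[OF assms(1)] by (metis le_add2 plus_1_eq_Suc)
  moreover have "s (Suc n) = s n + \<Delta> s (Suc n)" by simp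
  ultimately show ?case
    using Suc by (simp add: algebra_simps del: seq_diff_Suc)
qed

text \<open>The four claims go through one induction because, for \<open>\<Delta> s\<close>,
  monotonicity feeds the invariant and the upper bound, and the invariant feeds the divergence. The
  upper bound starts at 1 since \<open>s 0\<close> may be positive.\<close>

lemma iterated_diff_concave_growth:
  assumes "s 0 \<ge> 0"
    and "concave_seq ((\<Delta> ^^ p) s)"
    and "\<not> bdd_above (range ((\<Delta> ^^ p) s))"
  shows "strict_mono s
    \<and> (\<forall>n. real n * \<Delta> s n \<le> real (p + 1) * s n)
    \<and> filterlim (\<lambda>n. s n / real n ^ p) at_top sequentially
    \<and> (\<exists>C. \<forall>n\<ge>1. s n \<le> C * real n ^ (p + 1))"
  using assms
proof (induction p arbitrary: s)
  case 0
  then have t: "concave_seq s" "\<not> bdd_above (range s)" by simp_all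
  have mono: "strict_mono s" by (rule concave_unbounded_strict_mono[OF t])
  \<comment> \<open>The line through the first two values is \<open>s 0 + n * (s 1 - s 0)\<close>,
    and \<open>s 0 \<le> n * s 0\<close> absorbs its constant term.\<close>
  have "s n \<le> s 1 * real n ^ (0 + 1)" if "n \<ge> 1" for n
  proof -
    have "s 0 * 1 \<le> s 0 * real n" using that 0 by (intro mult_left_mono) auto
    with concave_le_linear[OF t(1), of n] show ?thesis by (simp add: algebra_simps)
  qed
  moreover have "real n * \<Delta> s n \<le> s n" for n
    using concave_last_increment_le[OF t(1), of n] 0 by simp
  ultimately show ?case
    using mono strict_mono_unbounded_at_top[OF mono t(2)] by auto
next
  case (Suc p)
  define u where "u = \<Delta> s"
  have u0: "u 0 \<ge> 0" using Suc.prems by (simp add: u_def)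
  have "(\<Delta> ^^ Suc p) s = (\<Delta> ^^ p) u" by (simp add: u_def funpow_swap1)
  with Suc.IH[of u] u0 Suc.prems obtain C where mono: "strict_mono u"
    and w: "\<And>n. real n * \<Delta> u n \<le> real (p + 1) * u n"
    and lim: "filterlim (\<lambda>n. u n / real n ^ p) at_top sequentially"
    and C: "\<And>n. n \<ge> 1 \<Longrightarrow> u n \<le> C * real n ^ (p + 1)"
    by metis
  have pos: "u n > 0" if "n \<ge> 1" for n
    using strict_mono_nonneg_pos[OF mono u0 that] .
  have smono: "strict_mono s"
    using pos by (simp add: strict_mono_Suc_iff u_def)
      (metis One_nat_def Suc_le_mono diff_gt_0_iff_gt le0 seq_diff_Suc)
  have ws: "real n * u n \<le> real (p + 2) * s n" for n
    using seq_diff_weighted_step[of s "real (p + 1)" n] mono w Suc.prems(1)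
    by (simp add: u_def add.commute)
  have "filterlim (\<lambda>n. s n / real n ^ Suc p) at_top sequentially"
  proof (rule filterlim_at_top_mono)
    show "filterlim (\<lambda>n. (1 / real (p + 2)) * (u n / real n ^ p)) at_top sequentially"
      by (rule filterlim_tendsto_pos_mult_at_top[OF tendsto_const _ lim]) simp
    show "\<forall>\<^sub>F n in sequentially. (1 / real (p + 2)) * (u n / real n ^ p) \<le> s n / real n ^ Suc p"
      using eventually_ge_at_top[of 1]
    proof eventually_elim
      case (elim n)
      have "(1 / real (p + 2)) * (u n / real n ^ p)
          = (real n * u n / real (p + 2)) / real n ^ Suc p"
        using elim by simp
      also have "\<dots> \<le> s n / real n ^ Suc p"
        using ws[of n] by (intro divide_right_mono) (simp_all add: divide_le_eq mult.commute)
      finally show ?case .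
    qed
  qed
  moreover have "s n \<le> (2 * C) * real n ^ (Suc p + 1)" if "n \<ge> 1" for n
  proof -
    \<comment> \<open>\<open>s n\<close> is the sum of the \<open>n + 1\<close> terms
      \<open>u 0, ..., u n\<close>, the last being the largest; \<open>n + 1 \<le> 2 * n\<close>
      then yields the factor 2.\<close>
    have "s n \<le> real (n + 1) * u n"
    proof (induction n)
      case (Suc n)
      have "u n \<le> u (Suc n)" using strict_mono_leD[OF mono, of n "Suc n"] by simp
      then have "real (n + 1) * u n \<le> real (n + 1) * u (Suc n)" by (rule mult_left_mono) simp
      moreover have "s (Suc n) = s n + u (Suc n)" by (simp add: u_def)
      ultimately show ?case using Suc by (simp add: algebra_simps)
    qed (simp add: u_def)
    also have "\<dots> \<le> (2 * real n) * u n"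
      using that pos[OF that] by (intro mult_right_mono) auto
    also have "\<dots> \<le> (2 * real n) * (C * real n ^ (p + 1))"
      using C[OF that] by (intro mult_left_mono) auto
    finally show ?thesis by (simp add: algebra_simps)
  qed
  then have "\<exists>C. \<forall>n\<ge>1. s n \<le> C * real n ^ (Suc p + 1)" by blast
  ultimately show ?case
    using smono ws by (simp add: u_def)
qed

lemma ratio_tendsto_1:
  fixes s :: "nat \<Rightarrow> real"
  assumes "strict_mono s" "s 0 \<ge> 0" and "\<And>n. real n * \<Delta> s n \<le> q * s n"
  shows "(\<lambda>n. s (n + 1) / s n) \<longlonglongrightarrow> 1"
proof -
  have pos: "s (Suc n) > 0" for n
    using strict_mono_nonneg_pos[OF assms(1,2)] by simp
  have "(\<lambda>n. q / real (Suc n)) \<longlonglongrightarrow> 0"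
    by (rule LIMSEQ_Suc[OF lim_const_over_n])
  then have lower: "(\<lambda>n. 1 - q / real (Suc n)) \<longlonglongrightarrow> 1"
    using tendsto_diff[OF tendsto_const, of _ 0 sequentially 1] by simp
  \<comment> \<open>The reciprocal is squeezed because its denominator is positive for every
    \<open>n\<close>, whereas \<open>s 0\<close> may vanish.\<close>
  have "(\<lambda>n. s n / s (Suc n)) \<longlonglongrightarrow> 1"
  proof (rule tendsto_sandwich[OF _ _ lower tendsto_const])
    have "1 - q / real (Suc n) \<le> s n / s (Suc n)" for n
      using assms(3)[of "Suc n"] pos[of n] by (simp add: field_simps del: of_nat_Suc)
    then show "\<forall>\<^sub>F n in sequentially. 1 - q / real (Suc n) \<le> s n / s (Suc n)" by simp
    have "s n / s (Suc n) \<le> 1" for n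
      using strict_mono_leD[OF assms(1), of n "Suc n"] pos[of n] by simp
    then show "\<forall>\<^sub>F n in sequentially. s n / s (Suc n) \<le> 1" by simp
  qed
  then have "(\<lambda>n. inverse (s n / s (Suc n))) \<longlonglongrightarrow> inverse 1"
    by (rule tendsto_inverse) simp
  then show ?thesis by simp
qed

theorem theorem4p7:
  fixes s :: "nat \<Rightarrow> real" and p :: nat
  assumes "s 0 \<ge> 0"
    and "concave_seq ((\<Delta> ^^ p) s)"
    and "\<not> bdd_above (range ((\<Delta> ^^ p) s))"
  shows "(\<forall>n\<ge>1. s n > 0)
    \<and> strict_mono s
    \<and> filterlim (\<lambda>n. s n / real n ^ p) at_top sequentially
    \<and> filterlim s at_top sequentially
    \<and> bounded ((\<lambda>n. s n / real n ^ (p + 1)) ` {1..})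
    \<and> (\<lambda>n. s (n + 1) / s n) \<longlonglongrightarrow> 1
    \<and> (\<Delta> ^^ (p + 2)) s \<in> \<ell>\<^sub>1
    \<and> (p \<ge> 1 \<longrightarrow> convex_seq s)"
proof -
  obtain C where mono: "strict_mono s"
    and w: "\<And>n. real n * \<Delta> s n \<le> real (p + 1) * s n"
    and lim: "filterlim (\<lambda>n. s n / real n ^ p) at_top sequentially"
    and C: "\<And>n. n \<ge> 1 \<Longrightarrow> s n \<le> C * real n ^ (p + 1)"
    using iterated_diff_concave_growth[OF assms] by auto
  have pos: "s n > 0" if "n \<ge> 1" for n
    using strict_mono_nonneg_pos[OF mono assms(1) that] .
  have "\<forall>\<^sub>F n in sequentially. s n / real n ^ p \<le> s n"
    using eventually_ge_at_top[of 1]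
  proof eventually_elim
    case (elim n)
    then have "s n * 1 \<le> s n * real n ^ p"
      using pos[OF elim] by (intro mult_left_mono one_le_power) auto
    then show ?case using elim by (simp add: divide_le_eq)
  qed
  then have lim_s: "filterlim s at_top sequentially"
    by (rule filterlim_at_top_mono[OF lim])
  have "\<bar>s n / real n ^ (p + 1)\<bar> \<le> C" if "n \<ge> 1" for n
    using C[OF that] pos[OF that] that by (simp add: divide_le_eq abs_of_pos)
  then have bd: "bounded ((\<lambda>n. s n / real n ^ (p + 1)) ` {1..})"
    unfolding bounded_iff by (intro exI[of _ C]) auto
  have ell: "(\<Delta> ^^ (p + 2)) s \<in> \<ell>\<^sub>1"
    using concave_unbounded_second_diff_summable[OF assms(2,3)] by simp
  have "convex_seq s" if "p \<ge> 1"
  proof -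
    \<comment> \<open>With one difference peeled off, the growth lemma applies to
      \<open>\<Delta> s\<close> at order \<open>p - 1\<close>: the increments of \<open>s\<close>
      are values of a strictly increasing sequence.\<close>
    obtain r where "p = Suc r" using \<open>p \<ge> 1\<close> by (cases p) simp_all
    then have "(\<Delta> ^^ p) s = (\<Delta> ^^ r) (\<Delta> s)" by (simp add: funpow_swap1)
    then have "strict_mono (\<Delta> s)"
      using iterated_diff_concave_growth[of "\<Delta> s" r] assms by simp
    then have "\<Delta> s (Suc n) \<le> \<Delta> s (Suc (Suc n))" for n
      by (rule strict_mono_leD) simp
    then show ?thesis by (simp add: convex_seq_def incseq_Suc_iff)
  qed
  with pos mono lim lim_s bd ell ratio_tendsto_1[OF mono assms(1) w] show ?thesis
    by blast
qed

end
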